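(* Let $R=\mathbb C[x_1,\dots,x_n]$, let $A\in R^{\ell\times k}$ be a polynomial matrix with complex coefficients, and let $(A_c,A_u,S)$ be a controllable-uncontrollable decomposition of $A$ (with $\mathcal F=C^\infty(\mathbb R^n,\mathbb C)$). Then $$\ker_{\mathbb C}A_u(\xi)=\{0\}\quad\text{for all }\xi\in\mathbb C^n\text{ such that }\operatorname{rank}_{\mathbb C}A(\xi)=\operatorname{rank}_{R}A.$$
   Context: Polynomial matrices over $R=\mathbb C[x_1,\dots,x_n]$ are identified with constant-coefficient linear differential operators by letting $x_i$ act as $\partial_i=\partial/\partial z_i$. For an $R$-module $\mathcal F$ of functions or distributions and a matrix $B$ over $R$ with $p$ rows and $q$ columns, $\ker_{\mathcal F}B=\{v\in\mathcal F^q: Bv=0\}$ and $\operatorname{im}_{\mathcal F}B=B\mathcal F^q\subseteq\mathcal F^p$; similarly $\ker_R B$, $\operatorname{im}_R B$. $\operatorname{rank}_R A$ is the largest size of a nonzero minor of $A$, equivalently the maximal value of $\operatorname{rank}_{\mathbb C}A(\xi)$ over $\xi\in\mathbb C^n$. For a submodule $N\subseteq R^k$, a prime ideal $P$ is an associated prime of $R^k/N$ if $P=\{r\in R: ru\in N\}$ for some $u\in R^k\setminus N$; $\operatorname{Ass}(R^k/N)$ is the set of these, and $R^k/N$ is $P$-primary if $\operatorname{Ass}(R^k/N)=\{P\}$. A controllable-uncontrollable decomposition of $A$ (with respect to $\mathcal F$) consists of polynomial matrices $A_c,A_u,S$ over $R$ (with $A_c$, $A_u$ having $k$ columns and $S$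 having $k$ rows) such that $\ker_{\mathcal F}A=\operatorname{im}_{\mathcal F}S+\ker_{\mathcal F}A_u$ and: (1) $\ker_{\mathcal F}A_c=\operatorname{im}_{\mathcal F}S$; (2) $R^k/\operatorname{im}_R A_c^\top$ is $(0)$-primary or trivial; (3) $(0)$ is not an associated prime of $R^k/\operatorname{im}_R A_u^\top$; (4) $\operatorname{im}_R A^\top=\operatorname{im}_R A_c^\top\cap\operatorname{im}_R A_u^\top$; (5) $\ker_R A_u=0$; (6) $\operatorname{Ass}(R^k/\operatorname{im}_R A^\top)$ is the disjoint union of $\operatorname{Ass}(R^k/\operatorname{im}_R A_c^\top)$ and $\operatorname{Ass}(R^k/\operatorname{im}_R A_u^\top)$. *)

theory Defs
  imports
    "HOL-Analysis.Analysis"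
    "HOL-Library.Poly_Mapping"
    "HOL-Algebra.Ideal"
    "Jordan_Normal_Form.Matrix_Kernel"
    "Jordan_Normal_Form.DL_Rank_Submatrix"
begin

text \<open>
  From here on \<open>$\<close> and the type name \<open>vec\<close> are those of \<open>Jordan_Normal_Form\<close>, whose matrices may
  have any numbers of rows and columns, including 0. Points of real and complex n-space still
  have type \<open>real ^ 'n\<close> and \<open>complex ^ 'n\<close>, with coordinates \<open>vec_nth\<close>.
\<close>

unbundle no vec_syntax

section \<open>The polynomial ring\<close>

text \<open>
  The ring of complex polynomials in the variables indexed by \<open>'n\<close>. Throughout,
  \<open>'n :: {finite, linorder}\<close> plays the role of the ordered index set \<open>{1, ..., n}\<close>, where
  n is \<open>CARD('n)\<close>. A polynomial is a finitely supported map from exponents to coefficients;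
  its multiplication is the convolution product.
\<close>

type_synonym 'n cpoly = "('n \<Rightarrow>\<^sub>0 nat) \<Rightarrow>\<^sub>0 complex"
type_synonym 'n rspace = "real ^ 'n"
type_synonym 'n cspace = "complex ^ 'n"

definition eval_cpoly :: "'n cspace \<Rightarrow> ('n::finite) cpoly \<Rightarrow> complex" where
  "eval_cpoly \<xi> p =
     (\<Sum>\<alpha>\<in>Poly_Mapping.keys p.
        Poly_Mapping.lookup p \<alpha> * (\<Prod>i\<in>UNIV. vec_nth \<xi> i ^ Poly_Mapping.lookup \<alpha> i))"

definition eval_mat :: "'n cspace \<Rightarrow> ('n::finite) cpoly mat \<Rightarrow> complex mat" where
  "eval_mat \<xi> A = map_mat (eval_cpoly \<xi>) A"

section \<open>Polynomials as differential operators\<close>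

definition partial :: "'n \<Rightarrow> ('n rspace \<Rightarrow> complex) \<Rightarrow> ('n::finite) rspace \<Rightarrow> complex" where
  "partial i f z = vector_derivative (\<lambda>t. f (z + t *\<^sub>R axis i 1)) (at 0)"

text \<open>
  The mixed partial derivative with exponent \<open>\<alpha>\<close>. The partial derivatives are composed in the
  order of the indices; on smooth functions the order does not matter.
\<close>

definition multi_partial ::
    "('n \<Rightarrow>\<^sub>0 nat) \<Rightarrow> ('n rspace \<Rightarrow> complex) \<Rightarrow> ('n::{finite,linorder}) rspace \<Rightarrow> complex" where
  "multi_partial \<alpha> =
     foldr (\<lambda>i g. (partial i ^^ Poly_Mapping.lookup \<alpha> i) \<circ> g) (sorted_list_of_set UNIV) id"

definition diff_op ::
    "('n::{finite,linorder}) cpoly \<Rightarrow> ('n rspace \<Rightarrow> complex) \<Rightarrow> 'n rspace \<Rightarrow> complex" where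
  "diff_op p f z =
     (\<Sum>\<alpha>\<in>Poly_Mapping.keys p. Poly_Mapping.lookup p \<alpha> * multi_partial \<alpha> f z)"

primrec C_k :: "nat \<Rightarrow> (('n::finite) rspace \<Rightarrow> complex) \<Rightarrow> bool" where
  "C_k 0 f \<longleftrightarrow> continuous_on UNIV f"
| "C_k (Suc m) f \<longleftrightarrow> f differentiable_on UNIV \<and> (\<forall>i. C_k m (partial i f))"

definition C_infinity :: "(('n::finite) rspace \<Rightarrow> complex) set" where
  "C_infinity = {f. \<forall>m. C_k m f}"

text \<open>
  For vectors of functions, zero and sums are written out pointwise, since the function type is
  not an instance of the algebraic classes here.
\<close>

definition diff_op_mat ::
    "('n::{finite,linorder}) cpoly mat \<Rightarrow> ('n rspace \<Rightarrow> complex) vec \<Rightarrow> ('n rspace \<Rightarrow> complex) vec" where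
  "diff_op_mat B v =
     vec (dim_row B) (\<lambda>i z. \<Sum>j<dim_col B. diff_op (B $$ (i, j)) (v $ j) z)"

definition ker_fun ::
    "('n rspace \<Rightarrow> complex) set \<Rightarrow> ('n::{finite,linorder}) cpoly mat \<Rightarrow> ('n rspace \<Rightarrow> complex) vec set" where
  "ker_fun F B =
     {v \<in> carrier_vec (dim_col B). set\<^sub>v v \<subseteq> F \<and> diff_op_mat B v = vec (dim_row B) (\<lambda>i z. 0)}"

definition im_fun ::
    "('n rspace \<Rightarrow> complex) set \<Rightarrow> ('n::{finite,linorder}) cpoly mat \<Rightarrow> ('n rspace \<Rightarrow> complex) vec set" where
  "im_fun F B = {diff_op_mat B v | v. v \<in> carrier_vec (dim_col B) \<and> set\<^sub>v v \<subseteq> F}"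

definition sum_fun ::
    "nat \<Rightarrow> ('b \<Rightarrow> complex) vec set \<Rightarrow> ('b \<Rightarrow> complex) vec set \<Rightarrow> ('b \<Rightarrow> complex) vec set" where
  "sum_fun k V W = {vec k (\<lambda>i z. (v $ i) z + (w $ i) z) | v w. v \<in> V \<and> w \<in> W}"

section \<open>Images, rank and associated primes\<close>

definition mat_image :: "'a::comm_ring_1 mat \<Rightarrow> 'a vec set" where
  "mat_image B = {B *\<^sub>v v | v. v \<in> carrier_vec (dim_col B)}"

text \<open>
  The largest size of a nonzero minor. Since the empty minor is 1, the maximum exists and is 0
  for a zero matrix.
\<close>

definition minor_rank :: "'a::comm_ring_1 mat \<Rightarrow> nat" where
  "minor_rank A =
     Max {card I | I J. I \<subseteq> {..<dim_row A} \<and> J \<subseteq> {..<dim_col A} \<and> card I = card J \<and>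
                        det (submatrix A I J) \<noteq> 0}"

text \<open>
  The associated primes of the quotient of the free module of rank k by its submodule \<open>N\<close>.
\<close>

definition ass_primes :: "nat \<Rightarrow> 'a::comm_ring_1 vec set \<Rightarrow> 'a set set" where
  "ass_primes k N =
     {P. primeideal P class_ring \<and> (\<exists>u \<in> carrier_vec k - N. P = {r. r \<cdot>\<^sub>v u \<in> N})}"

definition primary_quotient :: "nat \<Rightarrow> 'a::comm_ring_1 vec set \<Rightarrow> 'a set \<Rightarrow> bool" where
  "primary_quotient k N P \<longleftrightarrow> ass_primes k N = {P}"

section \<open>Controllable-uncontrollable decompositions\<close>

definition cu_decomposition ::
    "('n rspace \<Rightarrow> complex) set \<Rightarrow> ('n::{finite,linorder}) cpoly mat \<Rightarrow>
     'n cpoly mat \<Rightarrow> 'n cpoly mat \<Rightarrow> 'n cpoly mat \<Rightarrow> bool" where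
  "cu_decomposition F A A\<^sub>c A\<^sub>u S \<longleftrightarrow>
     (let k = dim_col A;
          N = mat_image (transpose_mat A);
          N\<^sub>c = mat_image (transpose_mat A\<^sub>c);
          N\<^sub>u = mat_image (transpose_mat A\<^sub>u)
      in dim_col A\<^sub>c = k \<and> dim_col A\<^sub>u = k \<and> dim_row S = k \<and>
         ker_fun F A = sum_fun k (im_fun F S) (ker_fun F A\<^sub>u) \<and>
         ker_fun F A\<^sub>c = im_fun F S \<and>
         (primary_quotient k N\<^sub>c {0} \<or> N\<^sub>c = carrier_vec k) \<and>
         {0} \<notin> ass_primes k N\<^sub>u \<and>
         N = N\<^sub>c \<inter> N\<^sub>u \<and>
         mat_kernel A\<^sub>u = {0\<^sub>v k} \<and>
         ass_primes k N = ass_primes k N\<^sub>c \<union> ass_primes k N\<^sub>u \<and>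
         ass_primes k N\<^sub>c \<inter> ass_primes k N\<^sub>u = {})"

end

theory Submission
  imports Defs
begin

text \<open>
  Write \<open>N\<close> and \<open>N\<^sub>u\<close> for the row modules of \<open>A\<close> and \<open>A\<^sub>u\<close>, and \<open>m\<close> for the maximal ideal of
  polynomials vanishing at \<open>\<xi>\<close>. The theorem holds because at a point where the rank does not drop,
  the quotient by \<open>N\<close> is locally free, hence torsion-free, whereas the quotient by \<open>N\<^sub>u\<close> is
  torsion and all its associated primes are also associated to \<open>N\<close>. So none of them lies
  in \<open>m\<close>, the quotient by \<open>N\<^sub>u\<close> vanishes locally at \<open>\<xi>\<close>, and this says that \<open>A\<^sub>u(\<xi>)\<close> has full
  column rank.

  Local freeness enters only through a denominator. If \<open>rank A(\<xi>) = rank A = s\<close>, some minor \<open>d\<close> of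
  size \<open>s\<close> has \<open>d(\<xi>) \<noteq> 0\<close> while all larger minors of \<open>A\<close> vanish, and expanding these by Schur
  complements produces a matrix \<open>X\<close> with \<open>d A = A X A\<close> (\<open>generalized_inverse_at_full_rank\<close>). If
  \<open>r u = A\<^sup>T w\<close> with \<open>r \<noteq> 0\<close>, transposing gives \<open>d r u = A\<^sup>T X\<^sup>T A\<^sup>T w = r A\<^sup>T X\<^sup>T u\<close>, so \<open>d u\<close> lies
  in \<open>N\<close> (\<open>smult_in_image_cancel\<close>). Hence every associated prime of the quotient by \<open>N\<close> other than
  \<open>{0}\<close> contains \<open>d\<close>, and is not inside \<open>m\<close>.

  Suppose now that \<open>A\<^sub>u(\<xi>)\<close> is not injective. Then for some unit vector every polynomial that
  multiplies it into \<open>N\<^sub>u\<close> vanishes at \<open>\<xi>\<close> (\<open>mat_kernel_evalI\<close>). An annihilator that is maximal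
  among those contained in \<open>m\<close> is an associated prime of the quotient by \<open>N\<^sub>u\<close> inside \<open>m\<close>
  (\<open>associated_prime_below\<close>). It is not \<open>{0}\<close> and is associated to \<open>N\<close>: a contradiction. The
  maximal annihilator exists because polynomial rings over a field are Noetherian, which is
  derived from Dickson's lemma by comparing leading exponents
  (\<open>ideal_family_has_maximal_member\<close>).
\<close>

section \<open>Maximal members in families of polynomial ideals\<close>

text \<open>
  A monotone subsequence always exists; if it is decreasing, it is eventually constant because the
  natural numbers are well-ordered, and its tail is increasing as well.
\<close>

lemma nat_sequence_has_mono_subsequence:
  fixes t :: "nat \<Rightarrow> nat"
  shows "\<exists>h :: nat \<Rightarrow> nat. strict_mono h \<and> mono (t \<circ> h)"
proof -
  obtain f where f: "strict_mono f" "monoseq (\<lambda>n. t (f n))"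
    using seq_monosub by blast
  show ?thesis
  proof (cases "incseq (\<lambda>n. t (f n))")
    case True
    then have "mono (t \<circ> f)" by (simp add: comp_def)
    then show ?thesis using f(1) by blast
  next
    case False
    then have dec: "decseq (\<lambda>n. t (f n))"
      using f(2) by (simp add: monoseq_iff)
    define c where "c = (LEAST x. x \<in> range (\<lambda>n. t (f n)))"
    have "c \<in> range (\<lambda>n. t (f n))"
      unfolding c_def by (rule LeastI) (rule rangeI[of _ 0])
    then obtain n0 where n0: "c = t (f n0)" by blast
    have le: "c \<le> t (f n)" for n
      unfolding c_def by (rule Least_le) simp
    have const: "t (f (n + n0)) = c" for n
      using le[of "n + n0"] decseqD[OF dec, of n0 "n + n0"] n0 by auto
    have "strict_mono (\<lambda>n. f (n + n0))"
      using f(1) by (simp add: strict_mono_def)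
    moreover have "mono (t \<circ> (\<lambda>n. f (n + n0)))"
      by (simp add: mono_def const)
    ultimately show ?thesis by blast
  qed
qed

text \<open>
  Thinning out the sequence once per variable makes all coordinates weakly increasing, so that the
  first term of what remains lies below the second in every coordinate.
\<close>

lemma dickson:
  fixes s :: "nat \<Rightarrow> ('n::finite \<Rightarrow>\<^sub>0 nat)"
  obtains i j d where "i < j" "s j = d + s i"
proof -
  have "\<exists>g :: nat \<Rightarrow> nat. strict_mono g \<and> (\<forall>x\<in>V. mono (\<lambda>i. Poly_Mapping.lookup (s (g i)) x))"
    if "finite V" for V :: "'n set"
    using that
  proof (induction V)
    case empty
    have "strict_mono (\<lambda>i::nat. i)" by (simp add: strict_mono_def)
    then show ?case by blast
  next
    case (insert x V)
    then obtain g :: "nat \<Rightarrow> nat" where g: "strict_mono g"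
      "\<forall>x\<in>V. mono (\<lambda>i. Poly_Mapping.lookup (s (g i)) x)" by blast
    obtain h :: "nat \<Rightarrow> nat" where h: "strict_mono h"
      "mono ((\<lambda>i. Poly_Mapping.lookup (s (g i)) x) \<circ> h)"
      using nat_sequence_has_mono_subsequence by blast
    have "strict_mono (g \<circ> h)"
      using g(1) h(1) by (simp add: strict_mono_def)
    moreover have "\<forall>y\<in>insert x V. mono (\<lambda>i. Poly_Mapping.lookup (s ((g \<circ> h) i)) y)"
      using g(2) h strict_mono_mono[OF h(1)] by (auto simp: mono_def)
    ultimately show ?case by blast
  qed
  from this[of UNIV] obtain g :: "nat \<Rightarrow> nat" where g: "strict_mono g"
      "\<And>x. mono (\<lambda>i. Poly_Mapping.lookup (s (g i)) x)"
    by auto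
  have "s (g 1) = (s (g 1) - s (g 0)) + s (g 0)"
  proof (rule poly_mapping_eqI)
    fix x
    have "Poly_Mapping.lookup (s (g 0)) x \<le> Poly_Mapping.lookup (s (g 1)) x"
      using g(2)[of x] by (simp add: mono_def)
    then show "Poly_Mapping.lookup (s (g 1)) x
        = Poly_Mapping.lookup (s (g 1) - s (g 0) + s (g 0)) x"
      by (simp add: lookup_add lookup_minus)
  qed
  moreover have "g 0 < g 1"
    using g(1) by (simp add: strict_mono_def)
  ultimately show ?thesis using that by blast
qed

lemma exponent_nonneg:
  fixes d :: "'n::linorder \<Rightarrow>\<^sub>0 nat"
  shows "0 \<le> d"
proof -
  have "\<not> d < 0"
    by transfer (auto simp: less_fun_def)
  then show ?thesis by simp
qed

text \<open>
  The lexicographic order on exponents extends divisibility, so an infinite descending chain would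
  contradict Dickson's lemma.
\<close>

lemma wf_exponent_less:
  "wf {(a, b :: 'n::{finite,linorder} \<Rightarrow>\<^sub>0 nat). a < b}"
  unfolding wf_iff_no_infinite_down_chain
proof (rule notI, elim exE)
  fix s :: "nat \<Rightarrow> ('n \<Rightarrow>\<^sub>0 nat)"
  assume "\<forall>i. (s (Suc i), s i) \<in> {(a, b). a < b}"
  then have step: "s (Suc i) < s i" for i by simp
  have desc: "i < j \<Longrightarrow> s j < s i" for i j
    by (induction j) (auto simp: less_Suc_eq intro: step less_trans[OF step])
  obtain i j d where ij: "i < j" "s j = d + s i"
    using dickson by blast
  have "0 + s i \<le> d + s i"
    by (rule add_right_mono) (rule exponent_nonneg)
  then show False
    using desc[OF ij(1)] ij(2) by simp
qed

text \<open>
  Exponents are compared lexicographically. For the zero polynomial the value is unspecified.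
\<close>

definition lead_exponent :: "(('n::linorder \<Rightarrow>\<^sub>0 nat) \<Rightarrow>\<^sub>0 'b::zero) \<Rightarrow> ('n \<Rightarrow>\<^sub>0 nat)" where
  "lead_exponent p = Max (Poly_Mapping.keys p)"

lemma lead_exponent_in_keys: "p \<noteq> 0 \<Longrightarrow> lead_exponent p \<in> Poly_Mapping.keys p"
  unfolding lead_exponent_def by (rule Max_in) (simp_all add: poly_mapping_eq_iff fun_eq_iff flip: lookup_not_eq_zero_eq_in_keys ex_in_conv)

lemma le_lead_exponent: "a \<in> Poly_Mapping.keys p \<Longrightarrow> a \<le> lead_exponent p"
  unfolding lead_exponent_def by simp

lemma lookup_single_times:
  fixes q :: "('n \<Rightarrow>\<^sub>0 nat) \<Rightarrow>\<^sub>0 'b::comm_semiring_1"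
  shows "Poly_Mapping.lookup (Poly_Mapping.single m c * q) (m + a) = c * Poly_Mapping.lookup q a"
  by (simp add: lookup_mult lookup_single when_mult)

lemma keys_single_times:
  fixes q :: "('n \<Rightarrow>\<^sub>0 nat) \<Rightarrow>\<^sub>0 'b::comm_semiring_1"
  assumes "a \<in> Poly_Mapping.keys (Poly_Mapping.single m c * q)"
  obtains b where "b \<in> Poly_Mapping.keys q" "a = m + b"
  using subsetD[OF keys_mult assms] that by (auto split: if_splits)

lemma lead_exponent_single_times:
  fixes q :: "('n::linorder \<Rightarrow>\<^sub>0 nat) \<Rightarrow>\<^sub>0 'b::comm_semiring_1"
  assumes "q \<noteq> 0"
  shows "Poly_Mapping.single m 1 * q \<noteq> 0"
    and "lead_exponent (Poly_Mapping.single m 1 * q) = m + lead_exponent q"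
proof -
  have key: "m + lead_exponent q \<in> Poly_Mapping.keys (Poly_Mapping.single m 1 * q)"
    using lead_exponent_in_keys[OF assms] by (simp add: in_keys_iff lookup_single_times)
  then show "Poly_Mapping.single m 1 * q \<noteq> 0" by auto
  show "lead_exponent (Poly_Mapping.single m 1 * q) = m + lead_exponent q"
    unfolding lead_exponent_def[of "Poly_Mapping.single m 1 * q"]
  proof (rule Max_eqI)
    fix a assume "a \<in> Poly_Mapping.keys (Poly_Mapping.single m 1 * q)"
    then obtain b where "b \<in> Poly_Mapping.keys q" "a = m + b"
      by (rule keys_single_times)
    then show "a \<le> m + lead_exponent q"
      using add_left_mono[OF le_lead_exponent[of b q], of m] by simp
  qed (use key in auto)
qed

lemma ideal_class_ringD:
  assumes "ideal I (class_ring :: 'a::comm_ring_1 ring)"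
  shows "0 \<in> I" and "x \<in> I \<Longrightarrow> y \<in> I \<Longrightarrow> x + y \<in> I" and "x \<in> I \<Longrightarrow> y \<in> I \<Longrightarrow> x - y \<in> I"
    and "x \<in> I \<Longrightarrow> r * x \<in> I"
proof -
  interpret ideal I "class_ring :: 'a ring" by fact
  show 0: "0 \<in> I"
    using zero_closed by simp
  show add: "x \<in> I \<Longrightarrow> y \<in> I \<Longrightarrow> x + y \<in> I" for x y
    using a_closed[of x y] by simp
  show mul: "x \<in> I \<Longrightarrow> r * x \<in> I" for x r
    using I_l_closed[of x r] by simp
  show "x \<in> I \<Longrightarrow> y \<in> I \<Longrightarrow> x - y \<in> I"
    using add[of x "(- 1) * y"] mul[of y "- 1"] by simp
qed

lemma ideal_class_ringI:
  assumes "0 \<in> I" and "\<And>x y. x \<in> I \<Longrightarrow> y \<in> I \<Longrightarrow> x + y \<in> I"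
    and "\<And>r x. x \<in> I \<Longrightarrow> r * x \<in> I"
  shows "ideal I (class_ring :: 'a::comm_ring_1 ring)"
proof (rule idealI)
  show "ring (class_ring :: 'a ring)" by (rule class_ring.ring_axioms)
  show "subgroup I (add_monoid (class_ring :: 'a ring))"
  proof (rule subgroup.intro)
    fix a assume a: "a \<in> I"
    have "a_inv (class_ring :: 'a ring) a = (- 1) * a" by (simp add: class_ring_simps)
    then show "inv\<^bsub>add_monoid (class_ring :: 'a ring)\<^esub> a \<in> I"
      using assms(3)[OF a, of "- 1"] unfolding a_inv_def by metis
  qed (use assms in auto)
qed (use assms in \<open>auto simp: mult.commute\<close>)

text \<open>
  Division by leading terms: subtracting from \<open>p \<in> J\<close> a scalar multiple of some \<open>q \<in> I\<close> with the same
  leading exponent lowers the leading exponent, and well-founded induction applies.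
\<close>

lemma ideal_eq_if_same_lead_exponents:
  fixes I J :: "(('n::{finite,linorder} \<Rightarrow>\<^sub>0 nat) \<Rightarrow>\<^sub>0 'b::field) set"
  assumes I: "ideal I class_ring" and J: "ideal J class_ring" and IJ: "I \<subseteq> J"
    and lead: "\<And>p. p \<in> J \<Longrightarrow> p \<noteq> 0 \<Longrightarrow> \<exists>q\<in>I. q \<noteq> 0 \<and> lead_exponent q = lead_exponent p"
  shows "J = I"
proof -
  have "p \<in> J \<longrightarrow> p \<in> I" for p
  proof (induction "lead_exponent p" arbitrary: p rule: wf_induct_rule[OF wf_exponent_less])
    case (1 p)
    show ?case
    proof (cases "p = 0")
      case True
      then show ?thesis using ideal_class_ringD(1)[OF I] by simp
    next
      case False
      show ?thesis
      proof
        assume pJ: "p \<in> J"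
        obtain q where q: "q \<in> I" "q \<noteq> 0" "lead_exponent q = lead_exponent p"
          using lead[OF pJ False] by blast
        let ?a = "lead_exponent p"
        define c where "c = Poly_Mapping.lookup p ?a / Poly_Mapping.lookup q ?a"
        have qa: "Poly_Mapping.lookup q ?a \<noteq> 0"
          using lead_exponent_in_keys[OF q(2)] q(3) by (simp add: in_keys_iff)
        define r where "r = p - Poly_Mapping.single 0 c * q"
        have lk: "Poly_Mapping.lookup (Poly_Mapping.single 0 c * q) b = c * Poly_Mapping.lookup q b" for b
          using lookup_single_times[of 0 c q b] by simp
        have cq: "Poly_Mapping.single 0 c * q \<in> I"
          using ideal_class_ringD(4)[OF I q(1)] .
        have "r \<in> J"
          unfolding r_def using ideal_class_ringD(3)[OF J pJ] cq IJ by blast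
        \<comment> \<open>The constant \<open>c\<close> makes the coefficients at the common leading exponent cancel.\<close>
        have ra: "?a \<notin> Poly_Mapping.keys r"
          unfolding in_keys_iff r_def lookup_minus lk using qa by (simp add: c_def)
        have "r \<in> I"
        proof (cases "r = 0")
          case True
          then show ?thesis using ideal_class_ringD(1)[OF I] by simp
        next
          case False
          have "Poly_Mapping.keys r \<subseteq> Poly_Mapping.keys p \<union> Poly_Mapping.keys q"
            by (auto simp: in_keys_iff r_def lookup_minus lk)
          then have "lead_exponent r \<le> ?a"
            using lead_exponent_in_keys[OF False] le_lead_exponent[of _ p] le_lead_exponent[of _ q] q(3) by auto
          moreover have "lead_exponent r \<noteq> ?a"
            using lead_exponent_in_keys[OF False] ra by auto
          ultimately have "lead_exponent r < ?a" by simp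
          then show ?thesis using 1 \<open>r \<in> J\<close> by blast
        qed
        moreover have "p = r + Poly_Mapping.single 0 c * q"
          by (simp add: r_def)
        ultimately show "p \<in> I"
          using ideal_class_ringD(2)[OF I] cq by metis
      qed
    qed
  qed
  then show ?thesis using IJ by blast
qed

text \<open>
  This is the Noetherian property. In a strictly ascending chain of ideals each step contributes a
  leading exponent that is new to the ideal before it; by Dickson's lemma one of these divides a later
  one, which is then not new, since the leading exponents of an ideal are closed under multiples.
\<close>

lemma ideal_family_has_maximal_member:
  fixes F :: "(('n::{finite,linorder} \<Rightarrow>\<^sub>0 nat) \<Rightarrow>\<^sub>0 'b::field) set set"
  assumes "F \<noteq> {}" and ideals: "\<And>I. I \<in> F \<Longrightarrow> ideal I class_ring"
  shows "\<exists>I\<in>F. \<forall>J\<in>F. I \<subseteq> J \<longrightarrow> J = I"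
proof (rule ccontr)
  assume "\<not> ?thesis"
  then have larger: "\<exists>J. J \<in> F \<and> I \<subset> J" if "I \<in> F" for I
    using that by blast
  obtain I0 where "I0 \<in> F" using assms(1) by blast
  obtain C where C: "\<And>i::nat. C i \<in> F" "\<And>i. C i \<subset> C (Suc i)"
    using dependent_nat_choice[of "\<lambda>_ I. I \<in> F" "\<lambda>_ I J. I \<subset> J"] \<open>I0 \<in> F\<close> larger by metis
  have mono: "C i \<subseteq> C j" if "i \<le> j" for i j
    using lift_Suc_mono_le[of C i j] C(2) that by blast
  have "\<exists>p\<in>C (Suc i). p \<noteq> 0 \<and> (\<forall>q\<in>C i. q \<noteq> 0 \<longrightarrow> lead_exponent q \<noteq> lead_exponent p)" for i
  proof (rule ccontr)
    assume "\<not> ?thesis"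
    then have "C (Suc i) = C i"
      using C(2)[of i] by (intro ideal_eq_if_same_lead_exponents ideals C(1)) auto
    then show False using C(2)[of i] by simp
  qed
  then obtain p where p: "\<And>i. p i \<in> C (Suc i)" "\<And>i. p i \<noteq> 0"
      "\<And>i q. q \<in> C i \<Longrightarrow> q \<noteq> 0 \<Longrightarrow> lead_exponent q \<noteq> lead_exponent (p i)"
    by metis
  obtain i j d where ij: "i < j" "lead_exponent (p j) = d + lead_exponent (p i)"
    using dickson[of "\<lambda>i. lead_exponent (p i)"] by blast
  have "p i \<in> C j"
    using p(1)[of i] mono[of "Suc i" j] ij(1) by auto
  then have "Poly_Mapping.single d 1 * p i \<in> C j"
    using ideal_class_ringD(4)[OF ideals[OF C(1)]] by blast
  then have "lead_exponent (Poly_Mapping.single d 1 * p i) \<noteq> lead_exponent (p j)"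
    by (rule p(3)) (rule lead_exponent_single_times(1)[OF p(2)])
  then show False
    using lead_exponent_single_times(2)[OF p(2)[of i], of d] ij(2) by simp
qed

section \<open>Associated primes below a prime ideal\<close>

text \<open>
  Choose \<open>u\<close> whose annihilator modulo \<open>N\<close> is maximal among the annihilators contained in \<open>m\<close>.
  Multiplying \<open>u\<close> by some \<open>t \<notin> m\<close> keeps the annihilator inside \<open>m\<close>, as \<open>m\<close> is prime, and therefore
  leaves it unchanged. So the maximal choice is saturated with respect to the complement of \<open>m\<close>, and
  the usual argument in the localization at \<open>m\<close> shows directly that it is prime.
\<close>

lemma associated_prime_below:
  fixes N :: "(('n::{finite,linorder} \<Rightarrow>\<^sub>0 nat) \<Rightarrow>\<^sub>0 'b::field) vec set"
  assumes N: "N \<subseteq> carrier_vec k"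
    and N0: "0\<^sub>v k \<in> N"
    and Nadd: "\<And>u v. u \<in> N \<Longrightarrow> v \<in> N \<Longrightarrow> u + v \<in> N"
    and Nsmult: "\<And>r u. u \<in> N \<Longrightarrow> r \<cdot>\<^sub>v u \<in> N"
    and m: "primeideal m class_ring"
    and u0: "u0 \<in> carrier_vec k" and ann_u0: "{r. r \<cdot>\<^sub>v u0 \<in> N} \<subseteq> m"
  obtains P where "P \<in> ass_primes k N" "P \<subseteq> m"
proof -
  interpret m: primeideal m class_ring by fact
  have one_m: "1 \<notin> m"
    using m.one_imp_carrier m.I_notcarr by auto
  have m_prime: "r * s \<in> m \<Longrightarrow> r \<in> m \<or> s \<in> m" for r s
    using m.I_prime[of r s] by simp
  define ann where "ann u = {r. r \<cdot>\<^sub>v u \<in> N}" for u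
  have ann_ideal: "ideal (ann u) class_ring" if "u \<in> carrier_vec k" for u
  proof (rule ideal_class_ringI)
    have "0 \<cdot>\<^sub>v u = 0\<^sub>v k" using that by auto
    then show "0 \<in> ann u" using N0 by (simp add: ann_def)
    show "x + y \<in> ann u" if "x \<in> ann u" "y \<in> ann u" for x y
      using that Nadd by (simp add: ann_def add_smult_distrib_vec)
    show "r * x \<in> ann u" if "x \<in> ann u" for r x
      using that Nsmult[of "x \<cdot>\<^sub>v u" r] by (simp add: ann_def smult_smult_assoc)
  qed
  have ann_smult: "s \<in> ann (t \<cdot>\<^sub>v u) \<longleftrightarrow> s * t \<in> ann u" for s t u
    by (simp add: ann_def smult_smult_assoc)
  let ?F = "{ann u | u. u \<in> carrier_vec k \<and> ann u \<subseteq> m}"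
  have "\<exists>I\<in>?F. \<forall>J\<in>?F. I \<subseteq> J \<longrightarrow> J = I"
  proof (rule ideal_family_has_maximal_member)
    show "?F \<noteq> {}" using u0 ann_u0 by (auto simp: ann_def)
  qed (use ann_ideal in auto)
  then obtain u where u: "u \<in> carrier_vec k" "ann u \<subseteq> m"
    and "\<forall>J\<in>?F. ann u \<subseteq> J \<longrightarrow> J = ann u" by auto
  then have max: "ann v = ann u" if "v \<in> carrier_vec k" "ann v \<subseteq> m" "ann u \<subseteq> ann v" for v
    using that by auto
  note uI = ideal_class_ringD[OF ann_ideal[OF u(1)]]
  have mult_max: "ann (t \<cdot>\<^sub>v u) = ann u" if "ann (t \<cdot>\<^sub>v u) \<subseteq> m" for t
  proof (rule max)
    show "ann u \<subseteq> ann (t \<cdot>\<^sub>v u)"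
      using uI(4) by (auto simp: ann_smult mult.commute)
  qed (use u(1) that in auto)
  \<comment> \<open>Multiplying \<open>u\<close> by \<open>t\<close> does not enlarge its annihilator, so elements outside \<open>m\<close> can be cancelled.\<close>
  have saturated: "s \<in> ann u" if "t * s \<in> ann u" "t \<notin> m" for s t
  proof -
    have "ann (t \<cdot>\<^sub>v u) \<subseteq> m"
    proof
      fix x assume "x \<in> ann (t \<cdot>\<^sub>v u)"
      then have "x * t \<in> m" using u(2) ann_smult by blast
      then show "x \<in> m" using m_prime that(2) by blast
    qed
    then show ?thesis
      using mult_max[of t] that(1) ann_smult[of s t u] by (simp add: mult.commute)
  qed
  have "primeideal (ann u) class_ring"
  proof (rule primeidealI)
    show "ideal (ann u) class_ring" by (rule ann_ideal[OF u(1)])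
    show "cring (class_ring :: (('n \<Rightarrow>\<^sub>0 nat) \<Rightarrow>\<^sub>0 'b) ring)" by (rule class_cring.cring_axioms)
    show "carrier class_ring \<noteq> ann u" using one_m u(2) by auto
    fix r s
    assume "r \<otimes>\<^bsub>class_ring\<^esub> s \<in> ann u"
    then have rs: "r * s \<in> ann u" by simp
    show "r \<in> ann u \<or> s \<in> ann u"
    proof (cases "ann (s \<cdot>\<^sub>v u) \<subseteq> m")
      case True
      then show ?thesis using mult_max[of s] rs by (auto simp flip: ann_smult)
    next
      case False
      then obtain t where "t \<notin> m" "t * s \<in> ann u" using ann_smult by blast
      then show ?thesis using saturated by blast
    qed
  qed
  moreover have "u \<notin> N"
  proof
    assume "u \<in> N"
    then have "1 \<in> ann u" by (simp add: ann_def)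
    then show False using one_m u(2) by blast
  qed
  ultimately have "ann u \<in> ass_primes k N"
    using u(1) unfolding ass_primes_def ann_def by blast
  then show thesis using that u(2) by blast
qed

lemma mult_mat_vec_smult:
  fixes B :: "'a::comm_ring_1 mat"
  assumes "B \<in> carrier_mat k q" and "v \<in> carrier_vec q"
  shows "B *\<^sub>v (r \<cdot>\<^sub>v v) = r \<cdot>\<^sub>v (B *\<^sub>v v)"
  using assms by (intro eq_vecI) auto

lemma mat_image_eq:
  assumes "B \<in> carrier_mat k q"
  shows "mat_image B = (\<lambda>v. B *\<^sub>v v) ` carrier_vec q"
  using assms by (auto simp: mat_image_def)

lemma mat_image_submodule:
  fixes B :: "'a::comm_ring_1 mat"
  assumes B: "B \<in> carrier_mat k q"
  shows "mat_image B \<subseteq> carrier_vec k" and "0\<^sub>v k \<in> mat_image B"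
    and "u \<in> mat_image B \<Longrightarrow> v \<in> mat_image B \<Longrightarrow> u + v \<in> mat_image B"
    and "u \<in> mat_image B \<Longrightarrow> r \<cdot>\<^sub>v u \<in> mat_image B"
proof -
  note im = mat_image_eq[OF B]
  show "mat_image B \<subseteq> carrier_vec k"
    unfolding im by (rule image_subsetI) (rule mult_mat_vec_carrier[OF B])
  have "B *\<^sub>v 0\<^sub>v q = 0\<^sub>v k"
    using B by (intro eq_vecI) auto
  then show "0\<^sub>v k \<in> mat_image B"
    unfolding im by (metis imageI zero_carrier_vec)
  show "u + v \<in> mat_image B" if u: "u \<in> mat_image B" and v: "v \<in> mat_image B"
  proof -
    obtain x where "x \<in> carrier_vec q" "u = B *\<^sub>v x"
      using u unfolding im by blast
    moreover obtain y where "y \<in> carrier_vec q" "v = B *\<^sub>v y"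
      using v unfolding im by blast
    ultimately have "u + v = B *\<^sub>v (x + y)" and "x + y \<in> carrier_vec q"
      using mult_add_distrib_mat_vec[OF B] by auto
    then show ?thesis unfolding im by blast
  qed
  show "r \<cdot>\<^sub>v u \<in> mat_image B" if u: "u \<in> mat_image B"
  proof -
    obtain x where x: "x \<in> carrier_vec q" "u = B *\<^sub>v x"
      using u unfolding im by blast
    then have "r \<cdot>\<^sub>v u = B *\<^sub>v (r \<cdot>\<^sub>v x)"
      using mult_mat_vec_smult[OF B] by metis
    then show ?thesis unfolding im using x(1) smult_carrier_vec by blast
  qed
qed

section \<open>Minors, rank and a generalized inverse\<close>

definition pick_rows :: "'a mat \<Rightarrow> nat \<Rightarrow> (nat \<Rightarrow> nat) \<Rightarrow> 'a mat" where
  "pick_rows A s f = mat s (dim_col A) (\<lambda>(i, j). A $$ (f i, j))"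

definition pick_cols :: "'a mat \<Rightarrow> nat \<Rightarrow> (nat \<Rightarrow> nat) \<Rightarrow> 'a mat" where
  "pick_cols A s g = mat (dim_row A) s (\<lambda>(i, j). A $$ (i, g j))"

text \<open>
  Rows and columns are selected by index functions instead of sets, in no particular order and possibly
  with repetitions; a minor is then bordered by one row and one column just by extending these
  functions.
\<close>

definition index_minor :: "'a::comm_ring_1 mat \<Rightarrow> nat \<Rightarrow> (nat \<Rightarrow> nat) \<Rightarrow> (nat \<Rightarrow> nat) \<Rightarrow> 'a" where
  "index_minor A s f g = det (mat s s (\<lambda>(i, j). A $$ (f i, g j)))"

lemma index_minor_transpose:
  assumes "f ` {..<s} \<subseteq> {..<dim_row A}" and "g ` {..<s} \<subseteq> {..<dim_col A}"
  shows "index_minor (transpose_mat A) s g f = index_minor A s f g"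
proof -
  let ?B = "mat s s (\<lambda>(i, j). A $$ (f i, g j))"
  have "mat s s (\<lambda>(i, j). transpose_mat A $$ (g i, f j)) = transpose_mat ?B"
    using assms by (intro eq_matI) (auto simp: image_subset_iff)
  then show ?thesis
    unfolding index_minor_def using det_transpose[of ?B s] by simp
qed

lemma index_minor_nonzero_inj:
  assumes "index_minor A s f g \<noteq> 0"
  shows "inj_on f {..<s}"
proof (rule inj_onI, rule ccontr)
  fix i j assume ij: "i \<in> {..<s}" "j \<in> {..<s}" "f i = f j" "i \<noteq> j"
  let ?B = "mat s s (\<lambda>(i, j). A $$ (f i, g j))"
  have "row ?B i = row ?B j"
    using ij by (intro eq_vecI) auto
  then have "det ?B = 0"
    using ij by (intro det_identical_rows[of ?B s i j]) auto
  then show False using assms by (simp add: index_minor_def)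
qed

text \<open>
  Listing the selected rows in increasing order only changes the sign. The function \<open>pick\<close> is the
  increasing enumeration of a set that submatrices are built with.
\<close>

lemma index_minor_sort_rows:
  assumes "index_minor A s f g \<noteq> 0"
  shows "index_minor A s (pick (f ` {..<s})) g \<noteq> 0"
proof -
  let ?I = "f ` {..<s}"
  have inj: "inj_on f {..<s}" by (rule index_minor_nonzero_inj[OF assms])
  define p where "p i = (if i < s then card {a \<in> ?I. a < f i} else i)" for i
  have pick_p: "pick ?I (p i) = f i" if "i < s" for i
    using that pick_card_in_set[of "f i" ?I] by (simp add: p_def)
  have less: "p i < s" if "i < s" for i
  proof -
    have "{a \<in> ?I. a < f i} \<subset> ?I" using that by auto
    then have "card {a \<in> ?I. a < f i} < card ?I" by (intro psubset_card_mono) auto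
    then show ?thesis using that inj by (simp add: p_def card_image)
  qed
  have "inj_on p {0..<s}"
  proof (rule inj_onI)
    fix i j assume "i \<in> {0..<s}" "j \<in> {0..<s}" "p i = p j"
    then show "i = j" using pick_p[of i] pick_p[of j] inj by (auto dest: inj_onD)
  qed
  then have "bij_betw p {0..<s} {0..<s}"
    unfolding bij_betw_def using less by (intro conjI endo_inj_surj) auto
  then have p: "p permutes {0..<s}"
    by (rule bij_imp_permutes) (simp add: p_def)
  let ?B = "mat s s (\<lambda>(i, j). A $$ (pick ?I i, g j))"
  have "mat s s (\<lambda>(i, j). A $$ (f i, g j)) = mat s s (\<lambda>(i, j). ?B $$ (p i, j))"
    using less pick_p by (intro eq_matI) auto
  then have "index_minor A s f g = signof p * det ?B"
    unfolding index_minor_def using det_permute_rows[OF _ p, of ?B] by simp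
  then show ?thesis using assms by (auto simp: index_minor_def)
qed

lemma index_minor_le_minor_rank:
  fixes A :: "'a::comm_ring_1 mat"
  assumes f: "f ` {..<s} \<subseteq> {..<dim_row A}" and g: "g ` {..<s} \<subseteq> {..<dim_col A}"
    and nz: "index_minor A s f g \<noteq> 0"
  shows "s \<le> minor_rank A"
proof -
  let ?I = "f ` {..<s}" and ?J = "g ` {..<s}"
  let ?R = "{card I | I J. I \<subseteq> {..<dim_row A} \<and> J \<subseteq> {..<dim_col A} \<and> card I = card J \<and>
                        det (submatrix A I J) \<noteq> 0}"
  have nzT: "index_minor (transpose_mat A) s g f \<noteq> 0"
    using nz index_minor_transpose[OF f g] by simp
  have cI: "card ?I = s" and cJ: "card ?J = s"
    using index_minor_nonzero_inj[OF nz] index_minor_nonzero_inj[OF nzT] by (simp_all add: card_image)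
  have pI: "pick ?I ` {..<s} \<subseteq> {..<dim_row A}"
    using pick_in_set[of _ ?I] cI f by auto
  have "index_minor A s (pick ?I) g \<noteq> 0"
    by (rule index_minor_sort_rows[OF nz])
  then have "index_minor (transpose_mat A) s g (pick ?I) \<noteq> 0"
    using index_minor_transpose[OF pI g] by simp
  then have "index_minor (transpose_mat A) s (pick ?J) (pick ?I) \<noteq> 0"
    by (rule index_minor_sort_rows)
  moreover have pJ: "pick ?J ` {..<s} \<subseteq> {..<dim_col A}"
    using pick_in_set[of _ ?J] cJ g by auto
  ultimately have "index_minor A s (pick ?I) (pick ?J) \<noteq> 0"
    using index_minor_transpose[OF pI pJ] by simp
  moreover have "{i. i < dim_row A \<and> i \<in> ?I} = ?I" "{j. j < dim_col A \<and> j \<in> ?J} = ?J"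
    using f g by auto
  ultimately have "det (submatrix A ?I ?J) \<noteq> 0"
    by (simp add: index_minor_def submatrix_def cI cJ)
  then have "s \<in> ?R"
    unfolding mem_Collect_eq using f g cI cJ by (intro exI[of _ ?I] exI[of _ ?J]) simp
  moreover have "finite ?R"
    by (rule finite_subset[of _ "card ` Pow {..<dim_row A}"]) auto
  ultimately show ?thesis unfolding minor_rank_def by (intro Max_ge)
qed

text \<open>
  The bordered matrix is multiplied on the right by a block triangular matrix, built from the adjugate
  of \<open>B\<close>, that clears its upper right block. What remains in the lower right corner is the Schur
  complement, cleared of denominators; it must vanish because the determinant does.
\<close>

lemma bordered_det_zero:
  fixes B :: "'a::idom mat"
  assumes B: "B \<in> carrier_mat s s" and b: "b \<in> carrier_mat s 1"
    and c: "c \<in> carrier_mat 1 s" and a: "a \<in> carrier_mat 1 1"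
    and nz: "det B \<noteq> 0" and zero: "det (four_block_mat B b c a) = 0"
  shows "det B * a $$ (0, 0) = (c * (adj_mat B * b)) $$ (0, 0)"
proof -
  let ?d = "det B"
  note adj = adj_mat[OF B]
  let ?M = "four_block_mat B b c a"
  let ?X = "four_block_mat (adj_mat B) (- (adj_mat B * b)) (0\<^sub>m 1 s) (?d \<cdot>\<^sub>m 1\<^sub>m 1)"
  let ?e = "?d \<cdot>\<^sub>m a - c * (adj_mat B * b)"
  have M: "?M \<in> carrier_mat (s + 1) (s + 1)" using B a by auto
  have X: "?X \<in> carrier_mat (s + 1) (s + 1)" using adj by auto
  have Ab: "adj_mat B * b \<in> carrier_mat s 1" using adj(1) b by auto
  have BAb: "B * (adj_mat B * b) = ?d \<cdot>\<^sub>m b"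
    using assoc_mult_mat[OF B adj(1) b] adj(2) b by (simp add: mult_smult_assoc_mat[of "1\<^sub>m s" s s b 1])
  have "?M * ?X = four_block_mat (B * adj_mat B + b * 0\<^sub>m 1 s) (B * (- (adj_mat B * b)) + b * (?d \<cdot>\<^sub>m 1\<^sub>m 1))
        (c * adj_mat B + a * 0\<^sub>m 1 s) (c * (- (adj_mat B * b)) + a * (?d \<cdot>\<^sub>m 1\<^sub>m 1))"
    by (rule mult_four_block_mat[OF B b c a adj(1)]) (use Ab in auto)
  also have "B * (- (adj_mat B * b)) + b * (?d \<cdot>\<^sub>m 1\<^sub>m 1) = 0\<^sub>m s 1"
  proof -
    have "B * (- (adj_mat B * b)) = - (?d \<cdot>\<^sub>m b)"
      using B adj b BAb by simp
    then show ?thesis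
      using mult_smult_distrib[OF b one_carrier_mat] b by (intro eq_matI) auto
  qed
  also have "c * (- (adj_mat B * b)) + a * (?d \<cdot>\<^sub>m 1\<^sub>m 1) = ?e"
  proof -
    have "c * (- (adj_mat B * b)) = - (c * (adj_mat B * b))"
      using c adj b by simp
    then show ?thesis
      using mult_smult_distrib[OF a one_carrier_mat] a c Ab by (intro eq_matI) auto
  qed
  also have "B * adj_mat B + b * 0\<^sub>m 1 s = ?d \<cdot>\<^sub>m 1\<^sub>m s"
    unfolding adj(2) right_mult_zero_mat[OF b] by (rule right_add_zero_mat) simp
  also have "c * adj_mat B + a * 0\<^sub>m 1 s = c * adj_mat B"
    unfolding right_mult_zero_mat[OF a] by (rule right_add_zero_mat) (use adj(1) c in auto)
  finally have MX: "?M * ?X = four_block_mat (?d \<cdot>\<^sub>m 1\<^sub>m s) (0\<^sub>m s 1) (c * adj_mat B) ?e" .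
  have e: "?e \<in> carrier_mat 1 1"
    using a by (intro minus_carrier_mat mult_carrier_mat[OF c Ab])
  have "det (?M * ?X) = det (?d \<cdot>\<^sub>m 1\<^sub>m s) * det ?e"
    unfolding MX
    by (rule det_four_block_mat_upper_right_zero[OF smult_carrier_mat[OF one_carrier_mat] refl mult_carrier_mat[OF c adj(1)] e])
  moreover have "det (?M * ?X) = 0"
    using det_mult[OF M X] zero by simp
  ultimately have "det ?e = 0" using nz by simp
  moreover have "det ?e = ?e $$ (0, 0)"
    by (rule det_single[OF e])
  moreover have "?e $$ (0, 0) = ?d * a $$ (0, 0) - (c * (adj_mat B * b)) $$ (0, 0)"
    using carrier_matD[OF mult_carrier_mat[OF c Ab]] carrier_matD[OF a]
    by (simp del: index_mult_mat)
  ultimately show ?thesis by simp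
qed

text \<open>
  Each entry of \<open>A\<close> borders the chosen minor to one that is larger by one row and one column, hence
  zero, and is thereby determined by the chosen rows and columns.
\<close>

lemma minor_times_matrix:
  fixes A :: "'a::idom mat"
  assumes A: "A \<in> carrier_mat l k"
    and f: "f ` {..<s} \<subseteq> {..<l}" and g: "g ` {..<s} \<subseteq> {..<k}"
    and nz: "index_minor A s f g \<noteq> 0"
    and larger: "\<And>f' g'. f' ` {..<Suc s} \<subseteq> {..<l} \<Longrightarrow> g' ` {..<Suc s} \<subseteq> {..<k} \<Longrightarrow>
        index_minor A (Suc s) f' g' = 0"
  shows "index_minor A s f g \<cdot>\<^sub>m A =
      pick_cols A s g * (adj_mat (mat s s (\<lambda>(i, j). A $$ (f i, g j))) * pick_rows A s f)"
    (is "_ = ?C * (adj_mat ?B * ?R)")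
proof (rule eq_matI)
  have C: "?C \<in> carrier_mat l s" and R: "?R \<in> carrier_mat s k" and B: "?B \<in> carrier_mat s s"
    using A by (auto simp: pick_cols_def pick_rows_def)
  note adj = adj_mat(1)[OF B]
  show "dim_row (index_minor A s f g \<cdot>\<^sub>m A) = dim_row (?C * (adj_mat ?B * ?R))"
    "dim_col (index_minor A s f g \<cdot>\<^sub>m A) = dim_col (?C * (adj_mat ?B * ?R))"
    using A C R by auto
  fix i j
  assume "i < dim_row (?C * (adj_mat ?B * ?R))" "j < dim_col (?C * (adj_mat ?B * ?R))"
  then have ij: "i < l" "j < k" using C R by auto
  define b where "b = mat s 1 (\<lambda>(p, q). A $$ (f p, j))"
  define c where "c = mat 1 s (\<lambda>(p, q). A $$ (i, g q))"
  define a where "a = mat 1 1 (\<lambda>(p, q). A $$ (i, j))"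
  have bca: "b \<in> carrier_mat s 1" "c \<in> carrier_mat 1 s" "a \<in> carrier_mat 1 1"
    by (auto simp: b_def c_def a_def)
  have "four_block_mat ?B b c a = mat (Suc s) (Suc s) (\<lambda>(p, q). A $$ ((f(s := i)) p, (g(s := j)) q))"
    by (rule eq_matI) (auto simp: b_def c_def a_def less_Suc_eq)
  then have "det (four_block_mat ?B b c a) = index_minor A (Suc s) (f(s := i)) (g(s := j))"
    unfolding index_minor_def by (rule arg_cong)
  also have "\<dots> = 0"
    using f g ij by (intro larger) (auto simp: less_Suc_eq image_subset_iff)
  finally have "det ?B * a $$ (0, 0) = (c * (adj_mat ?B * b)) $$ (0, 0)"
    using bordered_det_zero[OF B bca] nz by (simp add: index_minor_def)
  moreover have "row c 0 = row ?C i"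
    using A ij by (intro eq_vecI) (auto simp: c_def pick_cols_def)
  moreover have "col (adj_mat ?B * b) 0 = col (adj_mat ?B * ?R) j"
  proof -
    have "col b 0 = col ?R j"
      using A ij by (intro eq_vecI) (auto simp: b_def pick_rows_def)
    then show ?thesis
      using col_mult2[OF adj bca(1), of 0] col_mult2[OF adj R ij(2)] by simp
  qed
  ultimately show "(index_minor A s f g \<cdot>\<^sub>m A) $$ (i, j) = (?C * (adj_mat ?B * ?R)) $$ (i, j)"
    using A C R adj bca ij by (simp add: a_def index_minor_def)
qed

lemma pick_rows_eq_mult:
  fixes A :: "'a::comm_ring_1 mat"
  assumes "A \<in> carrier_mat l k" and "f ` {..<s} \<subseteq> {..<l}"
  shows "pick_rows A s f = mat s l (\<lambda>(p, i). if i = f p then 1 else 0) * A"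
proof (rule eq_matI)
  fix p j assume "p < dim_row (mat s l (\<lambda>(p, i). if i = f p then 1 else 0) * A)"
    "j < dim_col (mat s l (\<lambda>(p, i). if i = f p then 1 else 0) * A)"
  then have pj: "p < s" "j < k" using assms by auto
  then have "f p < l" using assms by auto
  have "(\<Sum>i = 0..<l. (if i = f p then 1 else 0) * A $$ (i, j)) = (\<Sum>i = 0..<l. if i = f p then A $$ (i, j) else 0)"
    by (rule sum.cong) auto
  also have "\<dots> = A $$ (f p, j)" using \<open>f p < l\<close> by simp
  finally show "pick_rows A s f $$ (p, j) = (mat s l (\<lambda>(p, i). if i = f p then 1 else 0) * A) $$ (p, j)"
    using assms pj by (simp add: pick_rows_def scalar_prod_def)
qed (use assms in \<open>auto simp: pick_rows_def\<close>)

lemma pick_cols_eq_mult: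
  fixes A :: "'a::comm_ring_1 mat"
  assumes A: "A \<in> carrier_mat l k" and g: "g ` {..<s} \<subseteq> {..<k}"
  shows "pick_cols A s g = A * transpose_mat (mat s k (\<lambda>(q, j). if j = g q then 1 else 0))"
    (is "_ = A * transpose_mat ?E")
proof -
  have "pick_cols A s g = transpose_mat (pick_rows (transpose_mat A) s g)"
    using A g by (intro eq_matI) (auto simp: pick_cols_def pick_rows_def image_subset_iff)
  also have "\<dots> = transpose_mat (?E * transpose_mat A)"
    using pick_rows_eq_mult[of "transpose_mat A" k l g s] A g by simp
  also have "\<dots> = A * transpose_mat ?E"
    using transpose_mult[of ?E s k "transpose_mat A" l] A by simp
  finally show ?thesis .
qed

text \<open>
  Picking rows and columns amounts to multiplying by selection matrices on the left and on the right, so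
  the factorization through a maximal nonzero minor takes the form \<open>A X A\<close>.
\<close>

lemma minor_generalized_inverse:
  fixes A :: "'a::idom mat"
  assumes A: "A \<in> carrier_mat l k"
    and f: "f ` {..<s} \<subseteq> {..<l}" and g: "g ` {..<s} \<subseteq> {..<k}"
    and nz: "index_minor A s f g \<noteq> 0"
    and larger: "\<And>f' g'. f' ` {..<Suc s} \<subseteq> {..<l} \<Longrightarrow> g' ` {..<Suc s} \<subseteq> {..<k} \<Longrightarrow>
        index_minor A (Suc s) f' g' = 0"
  obtains X where "X \<in> carrier_mat k l" "index_minor A s f g \<cdot>\<^sub>m A = A * (X * A)"
proof -
  let ?B = "mat s s (\<lambda>(i, j). A $$ (f i, g j))"
  let ?E = "mat s l (\<lambda>(p, i). if i = f p then 1 else 0) :: 'a mat"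
  let ?G = "transpose_mat (mat s k (\<lambda>(q, j). if j = g q then 1 else 0)) :: 'a mat"
  have adj: "adj_mat ?B \<in> carrier_mat s s" by (rule adj_mat(1)) simp
  have E: "?E \<in> carrier_mat s l" and G: "?G \<in> carrier_mat k s" by auto
  have "index_minor A s f g \<cdot>\<^sub>m A = (A * ?G) * (adj_mat ?B * (?E * A))"
    using minor_times_matrix[OF assms] pick_rows_eq_mult[OF A f] pick_cols_eq_mult[OF A g] by simp
  also have "\<dots> = A * (?G * (adj_mat ?B * (?E * A)))"
    by (rule assoc_mult_mat[OF A G]) (use adj E A in auto)
  also have "adj_mat ?B * (?E * A) = adj_mat ?B * ?E * A"
    by (rule assoc_mult_mat[OF adj E A, symmetric])
  also have "?G * (adj_mat ?B * ?E * A) = (?G * (adj_mat ?B * ?E)) * A"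
    by (rule assoc_mult_mat[symmetric]) (use adj E G A in auto)
  finally have "index_minor A s f g \<cdot>\<^sub>m A = A * ((?G * (adj_mat ?B * ?E)) * A)" .
  moreover have "?G * (adj_mat ?B * ?E) \<in> carrier_mat k l"
    using adj E G by auto
  ultimately show thesis using that by blast
qed

lemma rank_mult_le:
  fixes P :: "'a::field mat"
  assumes P: "P \<in> carrier_mat l s" and Q: "Q \<in> carrier_mat s k"
  shows "vec_space.rank l (P * Q) \<le> s"
proof -
  interpret vec_space "TYPE('a)" l .
  have PQ: "P * Q \<in> carrier_mat l k" using P Q by auto
  have colsP: "set (cols P) \<subseteq> carrier_vec l" using cols_dim[of P] P by auto
  have colsPQ: "set (cols (P * Q)) \<subseteq> carrier_vec l"
    using cols_dim[of "P * Q"] unfolding carrier_matD(1)[OF PQ] .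
  have sub: "set (cols (P * Q)) \<subseteq> span (set (cols P))"
  proof
    fix v assume "v \<in> set (cols (P * Q))"
    then obtain j where j: "j < k" "v = col (P * Q) j"
      using PQ by (auto simp: cols_def)
    then have "v = P *\<^sub>v col Q j" using col_mult2[OF P Q] by simp
    moreover have "col Q j \<in> carrier_vec s" using Q j by auto
    ultimately have "v \<in> col_space P"
      using P by (subst col_space_eq[OF P]) auto
    then show "v \<in> span (set (cols P))" by (simp add: col_space_def)
  qed
  have subspP: "subspace class_ring (span (set (cols P))) V"
    by (rule span_is_subspace) (use colsP in auto)
  have "span (set (cols (P * Q))) \<subseteq> span (set (cols P))"
    by (rule span_is_subset[OF sub]) (use subspP in \<open>auto simp: subspace_def\<close>)
  moreover have "subspace class_ring (span (set (cols (P * Q)))) V"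
    by (rule span_is_subspace) (use colsPQ in auto)
  ultimately have "subspace class_ring (span (set (cols (P * Q)))) (span_vs (set (cols P)))"
    using nested_subspaces[OF subspP] by blast
  moreover have "vectorspace class_ring (span_vs (set (cols P)))"
    using subspace_is_vs[OF subspP] .
  ultimately have "rank (P * Q) \<le> rank P"
    unfolding rank_def
    using vectorspace.subspace_dim[of class_ring "span_vs (set (cols P))" "span (set (cols (P * Q)))"]
      fin_dim_span_cols[OF P] fin_dim_span_cols[OF PQ] by simp
  then show ?thesis using rank_le_nc[OF P] by simp
qed

lemma rank_le_if_larger_minors_vanish:
  fixes A :: "'a::field mat"
  assumes A: "A \<in> carrier_mat l k"
    and f: "f ` {..<s} \<subseteq> {..<l}" and g: "g ` {..<s} \<subseteq> {..<k}"
    and nz: "index_minor A s f g \<noteq> 0"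
    and larger: "\<And>f' g'. f' ` {..<Suc s} \<subseteq> {..<l} \<Longrightarrow> g' ` {..<Suc s} \<subseteq> {..<k} \<Longrightarrow>
        index_minor A (Suc s) f' g' = 0"
  shows "vec_space.rank l A \<le> s"
proof -
  define d where "d = index_minor A s f g"
  define P where "P = pick_cols A s g"
  define Q where "Q = adj_mat (mat s s (\<lambda>(i, j). A $$ (f i, g j))) * pick_rows A s f"
  have factor: "d \<cdot>\<^sub>m A = P * Q"
    unfolding d_def P_def Q_def by (rule minor_times_matrix[OF assms])
  have P: "P \<in> carrier_mat l s" and R: "pick_rows A s f \<in> carrier_mat s k"
    using A by (auto simp: P_def pick_cols_def pick_rows_def)
  have Q: "Q \<in> carrier_mat s k"
    unfolding Q_def by (rule mult_carrier_mat[OF adj_mat(1) R]) simp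
  have "d \<noteq> 0" using nz by (simp add: d_def)
  then have "A = inverse d \<cdot>\<^sub>m (d \<cdot>\<^sub>m A)"
    by (intro eq_matI) auto
  then have "A = P * (inverse d \<cdot>\<^sub>m Q)"
    unfolding factor mult_smult_distrib[OF P Q] .
  then show ?thesis
    using rank_mult_le[OF P smult_carrier_mat[OF Q]] by metis
qed

text \<open>
  If \<open>r u = A\<^sup>T w\<close>, then \<open>d r u = A\<^sup>T X\<^sup>T A\<^sup>T w = r A\<^sup>T X\<^sup>T u\<close>, and \<open>r\<close> cancels. In other words,
  after inverting \<open>d\<close> the quotient by the row module of \<open>A\<close> is torsion-free.
\<close>

lemma smult_in_image_cancel:
  fixes A X :: "'a::idom mat"
  assumes A: "A \<in> carrier_mat l k" and X: "X \<in> carrier_mat k l"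
    and inv: "d \<cdot>\<^sub>m A = A * (X * A)"
    and u: "u \<in> carrier_vec k" and r: "r \<noteq> 0"
    and mem: "r \<cdot>\<^sub>v u \<in> mat_image (transpose_mat A)"
  shows "d \<cdot>\<^sub>v u \<in> mat_image (transpose_mat A)"
proof -
  have AT: "transpose_mat A \<in> carrier_mat k l" and XT: "transpose_mat X \<in> carrier_mat l k"
    using A X by auto
  obtain w where w: "w \<in> carrier_vec l" and ru: "r \<cdot>\<^sub>v u = transpose_mat A *\<^sub>v w"
    using mem unfolding mat_image_eq[OF AT] by blast
  let ?y = "transpose_mat X *\<^sub>v u"
  have y: "?y \<in> carrier_vec l" using XT u by simp
  have "d \<cdot>\<^sub>m transpose_mat A = transpose_mat (d \<cdot>\<^sub>m A)"
    using A by (intro eq_matI) auto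
  also have "\<dots> = transpose_mat (X * A) * transpose_mat A"
    unfolding inv by (rule transpose_mult[OF A]) (use X A in auto)
  also have "transpose_mat (X * A) = transpose_mat A * transpose_mat X"
    by (rule transpose_mult[OF X A])
  finally have dAT: "d \<cdot>\<^sub>m transpose_mat A = transpose_mat A * transpose_mat X * transpose_mat A" .
  have "d \<cdot>\<^sub>v (r \<cdot>\<^sub>v u) = (d \<cdot>\<^sub>m transpose_mat A) *\<^sub>v w"
    unfolding ru using AT w by (intro eq_vecI) auto
  also have "\<dots> = transpose_mat A * transpose_mat X *\<^sub>v (r \<cdot>\<^sub>v u)"
    unfolding dAT ru by (rule assoc_mult_mat_vec[OF mult_carrier_mat[OF AT XT] AT w])
  also have "\<dots> = r \<cdot>\<^sub>v (transpose_mat A * transpose_mat X *\<^sub>v u)"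
    by (rule mult_mat_vec_smult[OF mult_carrier_mat[OF AT XT] u])
  also have "transpose_mat A * transpose_mat X *\<^sub>v u = transpose_mat A *\<^sub>v ?y"
    by (rule assoc_mult_mat_vec[OF AT XT u])
  finally have eq: "d \<cdot>\<^sub>v (r \<cdot>\<^sub>v u) = r \<cdot>\<^sub>v (transpose_mat A *\<^sub>v ?y)" .
  have "d \<cdot>\<^sub>v u = transpose_mat A *\<^sub>v ?y"
  proof (rule eq_vecI)
    fix i assume "i < dim_vec (transpose_mat A *\<^sub>v ?y)"
    then have i: "i < k" using A by simp
    have "r * (d \<cdot>\<^sub>v u) $ i = (d \<cdot>\<^sub>v (r \<cdot>\<^sub>v u)) $ i"
      using u i by simp
    also have "\<dots> = r * (transpose_mat A *\<^sub>v ?y) $ i"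
      unfolding eq using A i by simp
    finally show "(d \<cdot>\<^sub>v u) $ i = (transpose_mat A *\<^sub>v ?y) $ i"
      using mult_left_cancel[OF r] by blast
  qed (use u A in auto)
  then show ?thesis
    unfolding mat_image_eq[OF AT] using y by blast
qed

section \<open>Evaluation at a point\<close>

lemma eval_cpoly_add: "eval_cpoly \<xi> (p + q) = eval_cpoly \<xi> p + eval_cpoly \<xi> q"
  unfolding eval_cpoly_def by (rule setsum_keys_plus_distrib) (simp_all add: distrib_right)

lemma eval_cpoly_zero: "eval_cpoly \<xi> 0 = 0"
  by (simp add: eval_cpoly_def)

lemma eval_cpoly_sum: "eval_cpoly \<xi> (sum f S) = (\<Sum>x\<in>S. eval_cpoly \<xi> (f x))"
  by (induction S rule: infinite_finite_induct) (simp_all add: eval_cpoly_add eval_cpoly_zero)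

lemma eval_cpoly_single:
  "eval_cpoly \<xi> (Poly_Mapping.single \<alpha> c) = c * (\<Prod>i\<in>UNIV. vec_nth \<xi> i ^ Poly_Mapping.lookup \<alpha> i)"
  by (simp add: eval_cpoly_def)

lemma sum_of_monomials:
  "p = (\<Sum>\<alpha>\<in>Poly_Mapping.keys p. Poly_Mapping.single \<alpha> (Poly_Mapping.lookup p \<alpha>))"
  by (rule poly_mapping_eqI) (simp add: lookup_sum lookup_single when_def in_keys_iff)

lemma eval_cpoly_mult: "eval_cpoly \<xi> (p * q) = eval_cpoly \<xi> p * eval_cpoly \<xi> q"
proof -
  let ?m = "\<lambda>p \<alpha>. Poly_Mapping.single \<alpha> (Poly_Mapping.lookup p \<alpha>)"
  have single: "eval_cpoly \<xi> (Poly_Mapping.single \<alpha> a * Poly_Mapping.single \<beta> b)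
      = eval_cpoly \<xi> (Poly_Mapping.single \<alpha> a) * eval_cpoly \<xi> (Poly_Mapping.single \<beta> b)" for \<alpha> \<beta> a b
    by (simp add: mult_single eval_cpoly_single lookup_add power_add prod.distrib)
  have "p * q = (\<Sum>\<alpha>\<in>Poly_Mapping.keys p. ?m p \<alpha>) * (\<Sum>\<beta>\<in>Poly_Mapping.keys q. ?m q \<beta>)"
    using sum_of_monomials[of p] sum_of_monomials[of q] by simp
  then have "eval_cpoly \<xi> (p * q)
      = (\<Sum>\<alpha>\<in>Poly_Mapping.keys p. \<Sum>\<beta>\<in>Poly_Mapping.keys q. eval_cpoly \<xi> (?m p \<alpha>) * eval_cpoly \<xi> (?m q \<beta>))"
    by (simp only: sum_product eval_cpoly_sum single)
  also have "\<dots> = eval_cpoly \<xi> (\<Sum>\<alpha>\<in>Poly_Mapping.keys p. ?m p \<alpha>) * eval_cpoly \<xi> (\<Sum>\<beta>\<in>Poly_Mapping.keys q. ?m q \<beta>)"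
    by (simp only: sum_product eval_cpoly_sum)
  also have "\<dots> = eval_cpoly \<xi> p * eval_cpoly \<xi> q"
    using sum_of_monomials[of p] sum_of_monomials[of q] by simp
  finally show ?thesis .
qed

lemma eval_cpoly_one: "eval_cpoly \<xi> 1 = 1"
  using eval_cpoly_single[of \<xi> 0 1] by simp

interpretation eval_cpoly: comm_ring_hom "eval_cpoly \<xi>"
  by standard (simp_all add: eval_cpoly_add eval_cpoly_mult eval_cpoly_one eval_cpoly_zero)

lemma primeideal_vanishing:
  "primeideal {p. eval_cpoly \<xi> p = 0} class_ring"
proof (rule primeidealI)
  show "ideal {p. eval_cpoly \<xi> p = 0} class_ring"
    by (rule ideal_class_ringI) (simp_all add: hom_distribs)
  show "cring (class_ring :: ('n::finite) cpoly ring)" by (rule class_cring.cring_axioms)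
  have "1 \<notin> {p. eval_cpoly \<xi> p = 0}" by simp
  moreover have "1 \<in> carrier class_ring" by simp
  ultimately show "carrier class_ring \<noteq> {p. eval_cpoly \<xi> p = 0}" by metis
qed (simp add: hom_distribs)

lemma index_minor_eval:
  assumes "A \<in> carrier_mat l k" and "f ` {..<s} \<subseteq> {..<l}" and "g ` {..<s} \<subseteq> {..<k}"
  shows "index_minor (eval_mat \<xi> A) s f g = eval_cpoly \<xi> (index_minor A s f g)"
proof -
  have "mat s s (\<lambda>(i, j). eval_mat \<xi> A $$ (f i, g j))
      = map_mat (eval_cpoly \<xi>) (mat s s (\<lambda>(i, j). A $$ (f i, g j)))"
    using assms by (intro eq_matI) (auto simp: eval_mat_def image_subset_iff)
  then show ?thesis
    unfolding index_minor_def by (simp only: eval_cpoly.hom_det)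
qed

text \<open>
  Take a nonzero minor of \<open>A(\<xi>)\<close> of the largest size \<open>s\<close>. Then \<open>A(\<xi>)\<close> factors through dimension \<open>s\<close>,
  so \<open>s\<close> bounds its rank, which is the generic rank by assumption. Therefore all minors of \<open>A\<close> of size
  \<open>s + 1\<close> vanish identically, and the chosen minor of \<open>A\<close> serves as the denominator \<open>d\<close>.
\<close>

lemma generalized_inverse_at_full_rank:
  fixes A :: "('n::{finite,linorder}) cpoly mat"
  assumes A: "A \<in> carrier_mat l k"
    and rank: "vec_space.rank l (eval_mat \<xi> A) = minor_rank A"
  obtains d X where "eval_cpoly \<xi> d \<noteq> 0" "X \<in> carrier_mat k l" "d \<cdot>\<^sub>m A = A * (X * A)"
proof -
  have A\<xi>: "eval_mat \<xi> A \<in> carrier_mat l k" using A by (simp add: eval_mat_def)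
  define minor where "minor s \<longleftrightarrow> (\<exists>f g. f ` {..<s} \<subseteq> {..<l} \<and> g ` {..<s} \<subseteq> {..<k} \<and>
      index_minor (eval_mat \<xi> A) s f g \<noteq> 0)" for s
  have bound: "s \<le> minor_rank A"
    if "f ` {..<s} \<subseteq> {..<l}" "g ` {..<s} \<subseteq> {..<k}" "index_minor A s f g \<noteq> 0" for s f g
    by (rule index_minor_le_minor_rank[OF _ _ that(3)]) (use that A in auto)
  have minor_le: "s \<le> minor_rank A" if "minor s" for s
    using that bound index_minor_eval[OF A] eval_cpoly_zero unfolding minor_def by metis
  have "minor 0"
    by (simp add: minor_def index_minor_def det_dim_zero)
  define s where "s = (GREATEST s. minor s)"
  have "minor s"
    unfolding s_def using \<open>minor 0\<close> minor_le by (rule GreatestI_nat)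
  have greatest: "t \<le> s" if "minor t" for t
    unfolding s_def using that minor_le by (rule Greatest_le_nat)
  obtain f g where f: "f ` {..<s} \<subseteq> {..<l}" and g: "g ` {..<s} \<subseteq> {..<k}"
    and nz: "index_minor (eval_mat \<xi> A) s f g \<noteq> 0"
    using \<open>minor s\<close> unfolding minor_def by blast
  have "index_minor (eval_mat \<xi> A) (Suc s) f' g' = 0"
    if "f' ` {..<Suc s} \<subseteq> {..<l}" "g' ` {..<Suc s} \<subseteq> {..<k}" for f' g'
    using that greatest[of "Suc s"] unfolding minor_def by auto
  then have "vec_space.rank l (eval_mat \<xi> A) \<le> s"
    by (rule rank_le_if_larger_minors_vanish[OF A\<xi> f g nz])
  then have "minor_rank A \<le> s" using rank by simp
  then have larger: "index_minor A (Suc s) f' g' = 0"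
    if "f' ` {..<Suc s} \<subseteq> {..<l}" "g' ` {..<Suc s} \<subseteq> {..<k}" for f' g'
    using bound[OF that] by fastforce
  have d: "eval_cpoly \<xi> (index_minor A s f g) \<noteq> 0"
    using nz index_minor_eval[OF A f g] by simp
  then have "index_minor A s f g \<noteq> 0" using eval_cpoly_zero by metis
  from minor_generalized_inverse[OF A f g this larger] obtain X
    where "X \<in> carrier_mat k l" "index_minor A s f g \<cdot>\<^sub>m A = A * (X * A)" by blast
  then show thesis using that d by blast
qed

text \<open>
  Every element of the row module of \<open>B\<close>, evaluated at \<open>\<xi>\<close>, is orthogonal to the kernel of \<open>B(\<xi>)\<close>. Under
  the hypothesis the evaluated row module contains a nonzero multiple of each unit vector.
\<close>

lemma mat_kernel_evalI:
  fixes B :: "('n::finite) cpoly mat"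
  assumes B: "B \<in> carrier_mat q k"
    and units: "\<And>i. i < k \<Longrightarrow>
        \<exists>p. eval_cpoly \<xi> p \<noteq> 0 \<and> p \<cdot>\<^sub>v unit_vec k i \<in> mat_image (transpose_mat B)"
  shows "mat_kernel (eval_mat \<xi> B) = {0\<^sub>v k}"
proof -
  have B\<xi>: "eval_mat \<xi> B \<in> carrier_mat q k" using B by (simp add: eval_mat_def)
  have BT: "transpose_mat B \<in> carrier_mat k q" using B by simp
  have "v = 0\<^sub>v k" if v: "v \<in> carrier_vec k" and ker: "eval_mat \<xi> B *\<^sub>v v = 0\<^sub>v q" for v
  proof (rule eq_vecI)
    fix i assume "i < dim_vec (0\<^sub>v k :: complex vec)"
    then have i: "i < k" by simp
    then obtain p w where p: "eval_cpoly \<xi> p \<noteq> 0" and w: "w \<in> carrier_vec q"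
      and pw: "p \<cdot>\<^sub>v unit_vec k i = transpose_mat B *\<^sub>v w"
      using units unfolding mat_image_eq[OF BT] by blast
    let ?w = "map_vec (eval_cpoly \<xi>) w"
    have "map_vec (eval_cpoly \<xi>) (p \<cdot>\<^sub>v unit_vec k i) = eval_cpoly \<xi> p \<cdot>\<^sub>v unit_vec k i"
      by (intro eq_vecI) (auto simp: unit_vec_def)
    moreover have "map_vec (eval_cpoly \<xi>) (transpose_mat B *\<^sub>v w) = transpose_mat (eval_mat \<xi> B) *\<^sub>v ?w"
      unfolding eval_mat_def eval_cpoly.mult_mat_vec_hom[OF BT w] by (simp add: map_mat_transpose)
    ultimately have ew: "eval_cpoly \<xi> p \<cdot>\<^sub>v unit_vec k i = transpose_mat (eval_mat \<xi> B) *\<^sub>v ?w"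
      using pw by simp
    have "eval_cpoly \<xi> p * v $ i = (eval_cpoly \<xi> p \<cdot>\<^sub>v unit_vec k i) \<bullet> v"
      using v i by (simp add: scalar_prod_smult_left scalar_prod_left_unit)
    also have "\<dots> = ?w \<bullet> (eval_mat \<xi> B *\<^sub>v v)"
      unfolding ew by (rule transpose_vec_mult_scalar[OF B\<xi> v]) (use w in simp)
    also have "\<dots> = 0" unfolding ker using w by simp
    finally show "v $ i = 0\<^sub>v k $ i" using p i by simp
  qed (use v in simp)
  moreover have "eval_mat \<xi> B *\<^sub>v 0\<^sub>v k = 0\<^sub>v q"
    using B\<xi> by (intro eq_vecI) auto
  ultimately show ?thesis
    unfolding mat_kernel_def using B\<xi> by auto
qed

theorem theorem1p2:
  fixes A A\<^sub>c A\<^sub>u S :: "('n::{finite,linorder}) cpoly mat"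
    and l k :: nat
  assumes "A \<in> carrier_mat l k"
    and "cu_decomposition C_infinity A A\<^sub>c A\<^sub>u S"
  shows "\<forall>\<xi> :: 'n cspace.
           vec_space.rank l (eval_mat \<xi> A) = minor_rank A \<longrightarrow>
           mat_kernel (eval_mat \<xi> A\<^sub>u) = {0\<^sub>v k}"
proof (intro allI impI)
  fix \<xi> :: "'n cspace"
  assume rank: "vec_space.rank l (eval_mat \<xi> A) = minor_rank A"
  note A = assms(1)
  let ?N = "mat_image (transpose_mat A)" and ?N\<^sub>u = "mat_image (transpose_mat A\<^sub>u)"
  have k: "dim_col A = k" using A by simp
  obtain q where A\<^sub>u: "A\<^sub>u \<in> carrier_mat q k"
    using assms(2) unfolding cu_decomposition_def Let_def k by auto
  have zero_notin: "{0} \<notin> ass_primes k ?N\<^sub>u"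
    and ass_subset: "ass_primes k ?N\<^sub>u \<subseteq> ass_primes k ?N"
    using assms(2) unfolding cu_decomposition_def Let_def k by auto
  have A\<^sub>uT: "transpose_mat A\<^sub>u \<in> carrier_mat k q" using A\<^sub>u by simp
  have AT: "transpose_mat A \<in> carrier_mat k l" using A by simp
  obtain d X where d: "eval_cpoly \<xi> d \<noteq> 0"
    and X: "X \<in> carrier_mat k l" "d \<cdot>\<^sub>m A = A * (X * A)"
    using generalized_inverse_at_full_rank[OF A rank] by blast
  show "mat_kernel (eval_mat \<xi> A\<^sub>u) = {0\<^sub>v k}"
  proof (rule mat_kernel_evalI[OF A\<^sub>u], rule ccontr)
    fix i
    assume "\<nexists>p. eval_cpoly \<xi> p \<noteq> 0 \<and> p \<cdot>\<^sub>v unit_vec k i \<in> ?N\<^sub>u"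
    then have "{p. p \<cdot>\<^sub>v unit_vec k i \<in> ?N\<^sub>u} \<subseteq> {p. eval_cpoly \<xi> p = 0}" by blast
    then obtain P where P: "P \<in> ass_primes k ?N\<^sub>u" "P \<subseteq> {p. eval_cpoly \<xi> p = 0}"
      using associated_prime_below[OF mat_image_submodule[OF A\<^sub>uT] primeideal_vanishing unit_vec_carrier]
      by metis
    then obtain u where u: "u \<in> carrier_vec k" "P = {r. r \<cdot>\<^sub>v u \<in> ?N}"
      using ass_subset unfolding ass_primes_def by blast
    have "0 \<cdot>\<^sub>v u = 0\<^sub>v k" using u(1) by auto
    then have "0 \<in> P" using u(2) mat_image_submodule(2)[OF AT] by simp
    moreover have "P \<noteq> {0}" using P(1) zero_notin by blast
    ultimately obtain r where "r \<noteq> 0" "r \<cdot>\<^sub>v u \<in> ?N" using u(2) by blast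
    then have "d \<cdot>\<^sub>v u \<in> ?N"
      using smult_in_image_cancel[OF A X u(1)] by blast
    then show False using P(2) u(2) d by blast
  qed
qed

end
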